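(* Let $\Omega=\mathbb T^d$ be the flat torus. Suppose that $f$ satisfies: - $f\in C^2(\mathbb T^d\times(0,\infty))\cap L^1_{\mathrm{loc}}(\mathbb T^d\times[0,\infty))$; - $uf,\ uf_x\in C(\mathbb T^d\times[0,\infty))$; - $f_u<0$; - $|f(x,u)|\le g_1(u)$ for a.a. $u>0$, with some $g_1\in L^1_{\mathrm{loc}}[0,\infty)$; - there is a function $m:\mathbb T^d\to(0,\infty)$ (not assumed to have mass $1$) with $f(x,m(x))=0$ for all $x\in\mathbb T^d$. Let $u^0\in L^1(\mathbb T^d)$, $u^0\ge0$, $\mathcal E(u^0)<\infty$. Then $$d_{HK}^2(u^0,m)\le C\,\mathcal E(u^0),$$ with $C$ independent of $u^0$.
   Context: $f_x$ denotes the gradient of $f(x,u)$ in $x$. The relative entropy of a nonnegative $u\in L^1(\mathbb T^d)$ (of any mass) is $\mathcal E(u)=\int_{\mathbb T^d}E(x,u(x))\,dx\in[0,\infty]$ with $E(x,u)=-\int_{m(x)}^uf(x,\xi)\,d\xi$ for $u\ge0$. Nonnegative integrable functions are identified with the corresponding measures. $\mathcal M^+$ is the set of (finite nonnegative) Radon measures on $\mathbb T^d$. The (conic) Hellinger–Kantorovich distance between $\rho_0,\rho_1\in\mathcal M^+$ is defined by $$d_{HK}^2(\rho_0,\rho_1)=\inf_{\mathcal A(\rho_0,\rho_1)}\int_0^1\left(\int_{\mathbb T^d}(|v_t|^2+|\alpha_t|^2)\,d\rho_t\right)dt,$$ where $\mathcal A(\rho_0,\rho_1)$ consists of all $(\rho_t,\alpha_t,v_t)_{t\in[0,1]}$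 such that $\rho\in C_w([0,1];\mathcal M^+)$ (weakly continuous curves), $\rho|_{t=0}=\rho_0$, $\rho|_{t=1}=\rho_1$, $(\alpha,v)\in L^2(0,1;L^2(d\rho_t)\times L^2(d\rho_t)^d)$ (scalar $\alpha_t$, vector $v_t$), and $\partial_t\rho_t+\operatorname{div}(\rho_tv_t)=\rho_t\alpha_t$ in the weak sense. *)

theory Defs
  imports "HOL-Analysis.Analysis"
begin

text \<open>
  The flat torus is \<open>\<real>\<^sup>d\<close> modulo \<open>\<int>\<^sup>d\<close>, with \<open>d = CARD('n)\<close>. Functions on the torus for which
  pointwise regularity matters are periodic functions on \<open>real^'n\<close>. Measures (and integrable
  functions, which matter only up to null sets) live on the half-open unit cube, which is a
  fundamental domain; the topology of the torus enters through the periodic continuous functions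
  they are tested against.
\<close>

definition periodic :: "(real^'n \<Rightarrow> 'b) \<Rightarrow> bool" where
  "periodic g \<longleftrightarrow> (\<forall>x i. g (x + axis i 1) = g x)"

definition torus :: "(real^'n) measure" where
  "torus = restrict_space lborel {x. \<forall>i. 0 \<le> x $ i \<and> x $ i < 1}"

definition radon_torus :: "(real^'n) measure set" where
  "radon_torus = {\<mu>. sets \<mu> = sets torus \<and> finite_measure \<mu>}"

definition meas_of :: "(real^'n \<Rightarrow> real) \<Rightarrow> (real^'n) measure" where
  "meas_of u = density torus (\<lambda>x. ennreal (u x))"


text \<open>\<open>C\<^sup>k\<close> regularity; intended for open sets \<open>S\<close>.\<close>

primrec Ck_on :: "nat \<Rightarrow> ('a::euclidean_space \<Rightarrow> real) \<Rightarrow> 'a set \<Rightarrow> bool" where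
  "Ck_on 0 g S \<longleftrightarrow> continuous_on S g"
| "Ck_on (Suc k) g S \<longleftrightarrow>
     (\<forall>x\<in>S. g differentiable (at x)) \<and>
     (\<forall>b\<in>Basis. Ck_on k (\<lambda>x. frechet_derivative g (at x) b) S)"

definition grad :: "(real^'n \<Rightarrow> real) \<Rightarrow> real^'n \<Rightarrow> real^'n" where
  "grad g x = (\<chi> i. frechet_derivative g (at x) (axis i 1))"

definition L1_loc :: "('a::euclidean_space \<Rightarrow> real) \<Rightarrow> 'a set \<Rightarrow> bool" where
  "L1_loc g S \<longleftrightarrow> (\<forall>K. compact K \<and> K \<subseteq> S \<longrightarrow> g absolutely_integrable_on K)"

text \<open>
  Continuity on the torus times \<open>[0,\<infinity>)\<close> of an expression that is only defined for \<open>u > 0\<close>: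
  it has a continuous extension up to \<open>u = 0\<close>.
\<close>

definition continuous_up_to_0 :: "(real^'n \<Rightarrow> real \<Rightarrow> 'b::topological_space) \<Rightarrow> bool" where
  "continuous_up_to_0 g \<longleftrightarrow>
     (\<exists>G. continuous_on (UNIV \<times> {0..}) G \<and> (\<forall>x u. u > 0 \<longrightarrow> G (x, u) = g x u))"


text \<open>The interval integral is oriented and does not see the value of \<open>f x\<close> at \<open>0\<close>.\<close>

definition entropy_density ::
    "(real^'n \<Rightarrow> real \<Rightarrow> real) \<Rightarrow> (real^'n \<Rightarrow> real) \<Rightarrow> real^'n \<Rightarrow> real \<Rightarrow> real" where
  "entropy_density f m x u = - (LBINT \<xi>=ereal (m x)..ereal u. f x \<xi>)"

text \<open>
  For \<open>f x\<close> decreasing with zero \<open>m x\<close>, the density is nonnegative on \<open>[0,\<infinity>)\<close>, so that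
  \<open>ennreal\<close> does not truncate.
\<close>

definition entropy ::
    "(real^'n \<Rightarrow> real \<Rightarrow> real) \<Rightarrow> (real^'n \<Rightarrow> real) \<Rightarrow> (real^'n \<Rightarrow> real) \<Rightarrow> ennreal" where
  "entropy f m u = (\<integral>\<^sup>+x. ennreal (entropy_density f m x (u x)) \<partial>torus)"


definition weakly_continuous_curve :: "(real \<Rightarrow> (real^'n) measure) \<Rightarrow> bool" where
  "weakly_continuous_curve \<rho> \<longleftrightarrow>
     (\<forall>t\<in>{0..1}. \<rho> t \<in> radon_torus) \<and>
     (\<forall>\<phi>::real^'n \<Rightarrow> real. continuous_on UNIV \<phi> \<and> periodic \<phi> \<longrightarrow>
        continuous_on {0..1} (\<lambda>t. LINT x|\<rho> t. \<phi> x))"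

text \<open>Smooth functions on \<open>(0,1)\<close> times the torus with compact support.\<close>

definition test_function :: "(real \<Rightarrow> real^'n \<Rightarrow> real) \<Rightarrow> bool" where
  "test_function \<phi> \<longleftrightarrow>
     (\<forall>k. Ck_on k (\<lambda>(t, x). \<phi> t x) UNIV) \<and> (\<forall>t. periodic (\<phi> t)) \<and>
     (\<exists>a b. 0 < a \<and> b < 1 \<and> (\<forall>t x. t \<notin> {a..b} \<longrightarrow> \<phi> t x = 0))"

text \<open>The equation \<open>\<partial>\<^sub>t \<rho> + div (\<rho> v) = \<rho> \<alpha>\<close> in the weak sense.\<close>

definition weak_continuity_eq ::
    "(real \<Rightarrow> (real^'n) measure) \<Rightarrow> (real \<Rightarrow> real^'n \<Rightarrow> real) \<Rightarrow> (real \<Rightarrow> real^'n \<Rightarrow> real^'n) \<Rightarrow> bool"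
  where
  "weak_continuity_eq \<rho> \<alpha> v \<longleftrightarrow>
     (\<forall>\<phi>. test_function \<phi> \<longrightarrow>
        (LBINT t:{0..1}. (LINT x|\<rho> t.
           deriv (\<lambda>s. \<phi> s x) t + grad (\<phi> t) x \<bullet> v t x + \<alpha> t x * \<phi> t x)) = 0)"

definition HK_action ::
    "(real \<Rightarrow> (real^'n) measure) \<Rightarrow> (real \<Rightarrow> real^'n \<Rightarrow> real) \<Rightarrow> (real \<Rightarrow> real^'n \<Rightarrow> real^'n) \<Rightarrow> ennreal"
  where
  "HK_action \<rho> \<alpha> v =
     (\<integral>\<^sup>+t\<in>{0..1}. (\<integral>\<^sup>+x. ennreal ((norm (v t x))\<^sup>2 + \<bar>\<alpha> t x\<bar>\<^sup>2) \<partial>\<rho> t) \<partial>lborel)"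

text \<open>
  The \<open>L\<^sup>2\<close> condition on \<open>(\<alpha>, v)\<close> is joint measurability in \<open>(t, x)\<close> plus finiteness of the action.
\<close>

definition HK_admissible ::
    "(real^'n) measure \<Rightarrow> (real^'n) measure \<Rightarrow>
     ((real \<Rightarrow> (real^'n) measure) \<times> (real \<Rightarrow> real^'n \<Rightarrow> real) \<times> (real \<Rightarrow> real^'n \<Rightarrow> real^'n)) set"
  where
  "HK_admissible \<rho>0 \<rho>1 = {(\<rho>, \<alpha>, v).
     weakly_continuous_curve \<rho> \<and> \<rho> 0 = \<rho>0 \<and> \<rho> 1 = \<rho>1 \<and>
     (\<lambda>(t, x). \<alpha> t x) \<in> borel_measurable (restrict_space lborel {0..1} \<Otimes>\<^sub>M torus) \<and>
     (\<lambda>(t, x). v t x) \<in> borel_measurable (restrict_space lborel {0..1} \<Otimes>\<^sub>M torus) \<and>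
     HK_action \<rho> \<alpha> v < \<infinity> \<and>
     weak_continuity_eq \<rho> \<alpha> v}"

definition HK_dist_sq :: "(real^'n) measure \<Rightarrow> (real^'n) measure \<Rightarrow> ennreal" where
  "HK_dist_sq \<rho>0 \<rho>1 = (INF (\<rho>, \<alpha>, v)\<in>HK_admissible \<rho>0 \<rho>1. HK_action \<rho> \<alpha> v)"

end

theory Submission
  imports Defs
begin

text \<open>
  The distance is bounded above by the action of a single curve along which mass is created and
  destroyed but never transported: \<open>v = 0\<close>. Writing \<open>p = \<surd>u\<^sup>0\<close> and \<open>q = \<surd>m\<close>, the curve has the
  densities \<open>r\<^sub>t\<^sup>2\<close> with \<open>r\<^sub>t = (1 - t) p + t q\<close>, and the growth rate \<open>\<alpha>\<^sub>t = 2 (q - p) / r\<^sub>t\<close> is what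
  makes \<open>\<partial>\<^sub>t r\<^sub>t\<^sup>2 = \<alpha>\<^sub>t r\<^sub>t\<^sup>2\<close>. Since \<open>\<alpha>\<^sub>t\<^sup>2 r\<^sub>t\<^sup>2 \<le> 4 (q - p)\<^sup>2\<close>, the squared distance is at most
  \<open>4 \<integral> (\<surd>u\<^sup>0 - \<surd>m)\<^sup>2\<close>, four times the squared Hellinger distance; this is the lemma
  \<open>HK_dist_sq_le_Hellinger\<close>.

  It remains to bound \<open>(\<surd>u - \<surd>m(x))\<^sup>2\<close> by a multiple of \<open>E(x, u)\<close> pointwise, with one constant for
  all \<open>x\<close> and \<open>u\<close>. As \<open>f(x, \<sqdot>)\<close> decreases strictly through its zero \<open>m(x)\<close>, the function \<open>m\<close> is
  continuous, so it lies between two positive constants on the closed cube, and by compactness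
  \<open>f\<^sub>u \<le> -c < 0\<close> for \<open>m(x)/2 \<le> u \<le> 2 m(x)\<close>. Hence \<open>f(x, \<sqdot>)\<close> leaves \<open>0\<close> at a definite speed near
  \<open>m(x)\<close>, and monotonicity keeps it away from \<open>0\<close> further out. Integrating these lower bounds for
  \<open>\<bar>f\<bar>\<close> makes \<open>E\<close> grow at least quadratically in \<open>u - m\<close> for \<open>u \<le> m\<close> and at least like
  \<open>(\<surd>u - \<surd>m)\<^sup>2\<close> for \<open>u \<ge> m\<close>; this is the lemma \<open>integral_ge_Hellinger\<close>.
\<close>

section \<open>Partial derivatives and the unit cube\<close>

lemma Ck_on_Suc_imp: "Ck_on (Suc k) g S \<Longrightarrow> Ck_on k g S"
proof (induction k arbitrary: g)
  case 0
  then show ?case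
    by (auto intro: continuous_at_imp_continuous_on differentiable_imp_continuous_within)
next
  case (Suc k)
  then show ?case
    unfolding Ck_on.simps(2)[of "Suc k"] Ck_on.simps(2)[of k] by blast
qed

lemma has_real_derivative_fst:
  fixes F :: "real \<times> 'a::real_normed_vector \<Rightarrow> real"
  assumes "F differentiable at (t, x)"
  shows "((\<lambda>s. F (s, x)) has_real_derivative frechet_derivative F (at (t, x)) (1, 0)) (at t)"
proof -
  let ?D = "frechet_derivative F (at (t, x))"
  have D: "(F has_derivative ?D) (at (t, x))"
    using assms by (simp add: frechet_derivative_works)
  have "((\<lambda>s. F (s, x)) has_derivative (\<lambda>h. ?D (h, 0))) (at t)"
    using has_derivative_compose[OF has_derivative_Pair[OF has_derivative_ident has_derivative_const] D]
    by simp
  moreover have "(\<lambda>h. ?D (h, 0)) = (*) (?D (1, 0))"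
  proof
    show "?D (h, 0) = ?D (1, 0) * h" for h
      using linear_cmul[OF has_derivative_linear[OF D], of h "(1, 0)"] by simp
  qed
  ultimately show ?thesis
    by (simp only: has_field_derivative_def)
qed

lemma has_real_derivative_snd:
  fixes F :: "'a::real_normed_vector \<times> real \<Rightarrow> real"
  assumes "F differentiable at (x, u)"
  shows "((\<lambda>s. F (x, s)) has_real_derivative frechet_derivative F (at (x, u)) (0, 1)) (at u)"
proof -
  let ?D = "frechet_derivative F (at (x, u))"
  have D: "(F has_derivative ?D) (at (x, u))"
    using assms by (simp add: frechet_derivative_works)
  have "((\<lambda>s. F (x, s)) has_derivative (\<lambda>h. ?D (0, h))) (at u)"
    using has_derivative_compose[OF has_derivative_Pair[OF has_derivative_const has_derivative_ident] D]
    by simp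
  moreover have "(\<lambda>h. ?D (0, h)) = (*) (?D (0, 1))"
  proof
    show "?D (0, h) = ?D (0, 1) * h" for h
      using linear_cmul[OF has_derivative_linear[OF D], of h "(0, 1)"] by simp
  qed
  ultimately show ?thesis
    by (simp only: has_field_derivative_def)
qed

text \<open>
  The torus is modelled on the half-open cube; bounds on it come from compactness of the closed one.
\<close>

abbreviation cube :: "(real^'n) set" where
  "cube \<equiv> cbox 0 (\<chi> i. 1)"

lemma space_torus: "space torus = {x::real^'n. \<forall>i. 0 \<le> x $ i \<and> x $ i < 1}"
  by (simp add: torus_def space_restrict_space)

lemma space_torus_subset: "space torus \<subseteq> (cube :: (real^'n) set)"
  by (auto simp: space_torus mem_box_cart less_imp_le)

lemma torus_domain_borel: "{x::real^'n. \<forall>i. 0 \<le> x $ i \<and> x $ i < 1} \<in> sets lborel"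
  by measurable

lemma finite_measure_torus: "finite_measure (torus :: (real^'n) measure)"
proof
  have "bounded {x::real^'n. \<forall>i. 0 \<le> x $ i \<and> x $ i < 1}"
    using bounded_cbox space_torus_subset unfolding space_torus by (rule bounded_subset)
  then have "emeasure lborel {x::real^'n. \<forall>i. 0 \<le> x $ i \<and> x $ i < 1} < \<infinity>"
    by (rule emeasure_bounded_finite)
  then show "emeasure torus (space (torus :: (real^'n) measure)) \<noteq> \<infinity>"
    using torus_domain_borel by (simp add: torus_def emeasure_restrict_space space_restrict_space)
qed

lemma measurable_torus: "g \<in> borel_measurable borel \<Longrightarrow> g \<in> borel_measurable torus"
  by (simp add: torus_def measurable_restrict_space1)

lemma bounded_on_compactE:
  fixes g :: "'a::topological_space \<Rightarrow> real"
  assumes "compact K" "continuous_on K g"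
  obtains B where "0 \<le> B" "\<And>x. x \<in> K \<Longrightarrow> \<bar>g x\<bar> \<le> B"
proof -
  have "bounded (g ` K)"
    by (rule compact_imp_bounded[OF compact_continuous_image[OF assms(2,1)]])
  then obtain B where "0 < B" "\<forall>y\<in>g ` K. norm y \<le> B"
    unfolding bounded_pos by blast
  then show ?thesis
    by (intro that[of B]) auto
qed

lemma integrable_torus_continuous_mult:
  fixes g h :: "real^'n \<Rightarrow> real"
  assumes g: "continuous_on UNIV g" and h: "integrable torus h"
  shows "integrable torus (\<lambda>x. g x * h x)"
proof -
  obtain B where B: "0 \<le> B" "\<And>x. x \<in> cube \<Longrightarrow> \<bar>g x\<bar> \<le> B"
    using bounded_on_compactE[OF compact_cbox continuous_on_subset[OF g subset_UNIV]] by metis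
  have [measurable]: "g \<in> borel_measurable torus" "h \<in> borel_measurable torus"
    using measurable_torus[OF borel_measurable_continuous_onI[OF g]] h by auto
  show ?thesis
  proof (rule Bochner_Integration.integrable_bound[where f="\<lambda>x. B * h x"])
    show "AE x in torus. norm (g x * h x) \<le> norm (B * h x)"
    proof (rule AE_I2)
      fix x :: "real^'n" assume "x \<in> space torus"
      then have "\<bar>g x\<bar> \<le> \<bar>B\<bar>"
        using B(1) B(2)[of x] space_torus_subset by auto
      then show "norm (g x * h x) \<le> norm (B * h x)"
        by (simp add: abs_mult mult_right_mono)
    qed
  qed (use h in auto)
qed

section \<open>The growth-only curve between two densities\<close>

definition root_interp :: "('a \<Rightarrow> real) \<Rightarrow> ('a \<Rightarrow> real) \<Rightarrow> real \<Rightarrow> 'a \<Rightarrow> real" where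
  "root_interp p q t x = (1 - t) * p x + t * q x"

text \<open>
  The logarithmic time derivative of the squared interpolation. Where the interpolation vanishes,
  division by zero gives the rate \<open>0\<close>, which is harmless because no mass sits there.
\<close>

definition root_rate :: "('a \<Rightarrow> real) \<Rightarrow> ('a \<Rightarrow> real) \<Rightarrow> real \<Rightarrow> 'a \<Rightarrow> real" where
  "root_rate p q t x = 2 * (q x - p x) / root_interp p q t x"

lemma integrable_root_products:
  fixes p q :: "'a \<Rightarrow> real"
  assumes [measurable]: "p \<in> borel_measurable M" "q \<in> borel_measurable M"
    and "integrable M (\<lambda>x. (p x)\<^sup>2)" "integrable M (\<lambda>x. (q x)\<^sup>2)"
  shows "integrable M (\<lambda>x. p x * q x)"
proof (rule Bochner_Integration.integrable_bound[where f="\<lambda>x. (p x)\<^sup>2 + (q x)\<^sup>2"])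
  have "\<bar>a * b\<bar> \<le> a\<^sup>2 + b\<^sup>2" for a b :: real
    using sum_squares_bound[of "\<bar>a\<bar>" "\<bar>b\<bar>"] zero_le_power2[of a] zero_le_power2[of b] abs_ge_zero[of "a * b"]
    unfolding abs_mult power2_abs by linarith
  then show "AE x in M. norm (p x * q x) \<le> norm ((p x)\<^sup>2 + (q x)\<^sup>2)"
    by simp
qed (use assms in auto)

text \<open>
  The density is a quadratic polynomial in time whose coefficients are integrable functions of
  space; both the finiteness of the mass and its continuity in time are read off from this.
\<close>

lemma root_interp_square:
  "(root_interp p q t x)\<^sup>2 = (1-t)\<^sup>2 * (p x)\<^sup>2 + 2*t*(1-t) * (p x * q x) + t\<^sup>2 * (q x)\<^sup>2"
  by (simp add: root_interp_def power2_eq_square algebra_simps)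

text \<open>The right-hand side is the time derivative of the density.\<close>

lemma root_rate_mult_square:
  "root_rate p q t x * (root_interp p q t x)\<^sup>2 = 2 * (q x - p x) * root_interp p q t x"
  by (simp add: root_rate_def power2_eq_square)

text \<open>
  The point of interpolating square roots linearly: away from the zeros of the density the action
  density does not depend on time. At a zero of the density the left-hand side is \<open>0\<close>.
\<close>

lemma root_rate_square_mult_square:
  "(root_rate p q t x)\<^sup>2 * (root_interp p q t x)\<^sup>2 \<le> 4 * (q x - p x)\<^sup>2"
proof (cases "root_interp p q t x = 0")
  case False
  then have "(root_rate p q t x)\<^sup>2 * (root_interp p q t x)\<^sup>2 = (2 * (q x - p x))\<^sup>2"
    unfolding root_rate_def by (simp only: power_mult_distrib[symmetric]) simp
  then show ?thesis
    by (simp only: power_mult_distrib) simp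
qed simp

lemma integral_meas_of:
  fixes h g :: "real^'n \<Rightarrow> real"
  assumes "h \<in> borel_measurable torus" "g \<in> borel_measurable torus" "\<And>x. 0 \<le> h x"
  shows "(LINT x|meas_of h. g x) = (LINT x|torus. g x * h x)"
  unfolding meas_of_def using assms by (subst integral_density) (auto simp: mult.commute)

lemma weakly_continuous_root_interp:
  fixes p q :: "real^'n \<Rightarrow> real"
  assumes [measurable]: "p \<in> borel_measurable torus" "q \<in> borel_measurable torus"
    and p: "integrable torus (\<lambda>x. (p x)\<^sup>2)" and q: "integrable torus (\<lambda>x. (q x)\<^sup>2)"
  shows "weakly_continuous_curve (\<lambda>t. meas_of (\<lambda>x. (root_interp p q t x)\<^sup>2))"
proof -
  have pq: "integrable torus (\<lambda>x. p x * q x)"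
    by (rule integrable_root_products) (use assms in auto)
  have m[measurable]: "root_interp p q t \<in> borel_measurable torus" for t
    unfolding root_interp_def by measurable
  have int: "integrable torus (\<lambda>x. (root_interp p q t x)\<^sup>2)" for t
    unfolding root_interp_square using p q pq by auto
  have "meas_of (\<lambda>x. (root_interp p q t x)\<^sup>2) \<in> radon_torus" for t
    using int[of t] unfolding radon_torus_def meas_of_def
    by (auto intro!: finite_measureI simp: emeasure_density integrable_iff_bounded
         cong: nn_integral_cong)
  moreover have "continuous_on {0..1} (\<lambda>t. LINT x|meas_of (\<lambda>x. (root_interp p q t x)\<^sup>2). \<phi> x)"
    if \<phi>: "continuous_on UNIV \<phi>" for \<phi> :: "real^'n \<Rightarrow> real"
  proof -
    note [simp] = integrable_torus_continuous_mult[OF \<phi> p] integrable_torus_continuous_mult[OF \<phi> q]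
      integrable_torus_continuous_mult[OF \<phi> pq]
    have [measurable]: "\<phi> \<in> borel_measurable torus"
      by (rule measurable_torus[OF borel_measurable_continuous_onI[OF \<phi>]])
    have "(LINT x|meas_of (\<lambda>x. (root_interp p q t x)\<^sup>2). \<phi> x) =
        (LINT x|torus. \<phi> x * (root_interp p q t x)\<^sup>2)" for t
      by (rule integral_meas_of) auto
    also have "\<dots> t = (LINT x|torus. (1-t)\<^sup>2 * (\<phi> x * (p x)\<^sup>2) + 2*t*(1-t) * (\<phi> x * (p x * q x))
        + t\<^sup>2 * (\<phi> x * (q x)\<^sup>2))" for t
      unfolding root_interp_square by (simp add: algebra_simps)
    also have "\<dots> t = (1-t)\<^sup>2 * (LINT x|torus. \<phi> x * (p x)\<^sup>2)
        + 2*t*(1-t) * (LINT x|torus. \<phi> x * (p x * q x)) + t\<^sup>2 * (LINT x|torus. \<phi> x * (q x)\<^sup>2)" for t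
      by (subst Bochner_Integration.integral_add, simp, simp)+ simp
    finally show ?thesis
      by (auto intro!: continuous_intros)
  qed
  ultimately show ?thesis
    unfolding weakly_continuous_curve_def by auto
qed

text \<open>
  Without velocity the equation is, for each point \<open>x\<close> separately, the ordinary differential
  equation \<open>\<partial>\<^sub>t r\<^sup>2 = \<alpha> r\<^sup>2\<close>. Tested with \<open>\<phi>\<close>, the integrand becomes the time derivative of \<open>\<phi> r\<^sup>2\<close>; after
  Fubini its time integral vanishes because \<open>\<phi>\<close> vanishes at both ends.
\<close>

lemma weak_continuity_root_interp:
  fixes p q :: "real^'n \<Rightarrow> real"
  assumes [measurable]: "p \<in> borel_measurable torus" "q \<in> borel_measurable torus"
    and p: "integrable torus (\<lambda>x. (p x)\<^sup>2)" and q: "integrable torus (\<lambda>x. (q x)\<^sup>2)"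
    and nonneg: "\<And>x. 0 \<le> p x" "\<And>x. 0 \<le> q x"
  shows "weak_continuity_eq (\<lambda>t. meas_of (\<lambda>x. (root_interp p q t x)\<^sup>2)) (root_rate p q) (\<lambda>t x. 0)"
  unfolding weak_continuity_eq_def
proof (intro allI impI)
  fix \<phi> :: "real \<Rightarrow> real^'n \<Rightarrow> real"
  assume \<phi>: "test_function \<phi>"
  let ?F = "\<lambda>(t, x). \<phi> t x"
  define \<psi> where "\<psi> = (\<lambda>z. frechet_derivative ?F (at z) (1, 0))"
  have C1: "Ck_on (Suc 0) ?F UNIV"
    using \<phi> unfolding test_function_def by blast
  have diff: "?F differentiable at z" for z
    using C1 by (cases z) simp
  have cont_F: "continuous_on UNIV ?F"
    using diff by (simp add: continuous_on_eq_continuous_at differentiable_imp_continuous_within)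
  have cont_\<psi>: "continuous_on UNIV \<psi>"
    using C1 unfolding \<psi>_def by (simp add: Basis_prod_def)
  have der: "((\<lambda>s. \<phi> s x) has_real_derivative \<psi> (t, x)) (at t)" for t x
    using has_real_derivative_fst[OF diff[of "(t, x)"]] by (simp add: \<psi>_def)
  have ends: "\<phi> 0 x = 0" "\<phi> 1 x = 0" for x
    using \<phi> unfolding test_function_def by (metis atLeastAtMost_iff not_le)+
  let ?K = "{0..1::real} \<times> (cube :: (real^'n) set)"
  have "compact ?K"
    by (intro compact_Times) auto
  obtain A where A: "0 \<le> A" "\<And>z. z \<in> ?K \<Longrightarrow> \<bar>?F z\<bar> \<le> A"
    using bounded_on_compactE[OF \<open>compact ?K\<close> continuous_on_subset[OF cont_F subset_UNIV]] by metis
  obtain B where B: "0 \<le> B" "\<And>z. z \<in> ?K \<Longrightarrow> \<bar>\<psi> z\<bar> \<le> B"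
    using bounded_on_compactE[OF \<open>compact ?K\<close> continuous_on_subset[OF cont_\<psi> subset_UNIV]] by metis
  let ?r = "root_interp p q"
  \<comment> \<open>the time derivative of \<open>\<phi> r\<^sup>2\<close>\<close>
  define G where "G t x = \<psi> (t, x) * (?r t x)\<^sup>2 + \<phi> t x * (2 * (q x - p x) * ?r t x)" for t x
  have meas_pair: "(\<lambda>z. H z) \<in> borel_measurable (lborel \<Otimes>\<^sub>M torus)" if "continuous_on UNIV H"
    for H :: "real \<times> (real^'n) \<Rightarrow> real"
  proof -
    have [measurable]: "(\<lambda>x. x) \<in> measurable torus (borel :: (real^'n) measure)"
      by (intro measurable_torus) simp
    have "(\<lambda>z. (fst z, snd z)) \<in> measurable (lborel \<Otimes>\<^sub>M torus) (borel :: (real \<times> (real^'n)) measure)"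
      unfolding borel_prod[symmetric] 
      by (intro measurable_Pair measurable_compose[OF measurable_snd]) (auto simp: measurable_torus)
    from measurable_compose[OF this borel_measurable_continuous_onI[OF that]]
    show ?thesis by simp
  qed
  note [measurable] = meas_pair[OF cont_F, unfolded case_prod_beta] meas_pair[OF cont_\<psi>]
  have [measurable]: "(\<lambda>z. ?r (fst z) (snd z)) \<in> borel_measurable (lborel \<Otimes>\<^sub>M torus)"
    unfolding root_interp_def by measurable
  interpret T: finite_measure "torus :: (real^'n) measure" by (rule finite_measure_torus)
  interpret P: pair_sigma_finite lborel "torus :: (real^'n) measure" ..
  let ?I = "\<lambda>t x. indicator {0..1} t * G t x"
  \<comment> \<open>On \<open>[0,1]\<close> one has \<open>r \<le> p + q\<close> and \<open>\<bar>q - p\<bar> \<le> p + q\<close>, and \<open>(p + q)\<^sup>2 \<le> 2 (p\<^sup>2 + q\<^sup>2)\<close>.\<close>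
  have int: "integrable (lborel \<Otimes>\<^sub>M torus) (\<lambda>(t, x). ?I t x)"
  proof (rule Bochner_Integration.integrable_bound)
    show "integrable (lborel \<Otimes>\<^sub>M torus)
        (\<lambda>(t, x). indicator {0..1::real} t * ((2 * B + 4 * A) * ((p x)\<^sup>2 + (q x)\<^sup>2)))"
      using p q by (intro P.Fubini_integrable) (simp_all add: abs_mult case_prod_beta)
    show "(\<lambda>(t, x). ?I t x) \<in> borel_measurable (lborel \<Otimes>\<^sub>M torus)"
      unfolding G_def case_prod_beta by measurable
    show "AE z in lborel \<Otimes>\<^sub>M torus. norm (case z of (t, x) \<Rightarrow> ?I t x) \<le>
        norm (case z of (t, x) \<Rightarrow> indicator {0..1::real} t * ((2 * B + 4 * A) * ((p x)\<^sup>2 + (q x)\<^sup>2)))"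
    proof (rule AE_I2)
      fix z :: "real \<times> (real^'n)" assume "z \<in> space (lborel \<Otimes>\<^sub>M torus)"
      then obtain t x where z: "z = (t, x)" "x \<in> cube"
        using space_torus_subset by (auto simp: space_pair_measure)
      show "norm (case z of (t, x) \<Rightarrow> ?I t x) \<le>
        norm (case z of (t, x) \<Rightarrow> indicator {0..1::real} t * ((2 * B + 4 * A) * ((p x)\<^sup>2 + (q x)\<^sup>2)))"
      proof (cases "t \<in> {0..1}")
        case True
        have r: "0 \<le> ?r t x" "?r t x \<le> p x + q x"
          using True nonneg by (auto simp: root_interp_def intro!: add_mono mult_left_le_one_le)
        have qp: "\<bar>q x - p x\<bar> \<le> p x + q x"
          using nonneg(1)[of x] nonneg(2)[of x] by linarith
        have s: "(p x + q x)\<^sup>2 \<le> 2 * ((p x)\<^sup>2 + (q x)\<^sup>2)"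
          using sum_squares_bound[of "p x" "q x"] by (simp add: power2_sum)
        have r2: "(?r t x)\<^sup>2 \<le> 2 * ((p x)\<^sup>2 + (q x)\<^sup>2)"
          using power_mono[OF r(2,1), of 2] s by linarith
        have "\<bar>q x - p x\<bar> * \<bar>?r t x\<bar> \<le> (p x + q x) * (p x + q x)"
          using r qp by (intro mult_mono) auto
        then have rqp: "\<bar>2 * (q x - p x) * ?r t x\<bar> \<le> 4 * ((p x)\<^sup>2 + (q x)\<^sup>2)"
          unfolding abs_mult power2_eq_square using s by (simp add: power2_eq_square)
        have "\<bar>G t x\<bar> \<le> \<bar>\<psi> (t, x)\<bar> * (?r t x)\<^sup>2 + \<bar>\<phi> t x\<bar> * \<bar>2 * (q x - p x) * ?r t x\<bar>"
          unfolding G_def by (rule order_trans[OF abs_triangle_ineq]) (simp add: abs_mult)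
        also have "\<dots> \<le> B * (2 * ((p x)\<^sup>2 + (q x)\<^sup>2)) + A * (4 * ((p x)\<^sup>2 + (q x)\<^sup>2))"
          using A(2)[of "(t, x)"] B(2)[of "(t, x)"] A(1) B(1) True z(2) r2 rqp
          by (intro add_mono mult_mono) auto
        finally show ?thesis
          using True A(1) B(1) by (simp add: z(1) algebra_simps)
      qed (simp add: z)
    qed
  qed
  have "(LINT x|meas_of (\<lambda>x. (?r t x)\<^sup>2).
           deriv (\<lambda>s. \<phi> s x) t + grad (\<phi> t) x \<bullet> 0 + root_rate p q t x * \<phi> t x) =
        (LINT x|torus. G t x)" for t
  proof -
    have [measurable]: "(\<lambda>x. \<psi> (t, x)) \<in> borel_measurable torus" "(\<lambda>x. \<phi> t x) \<in> borel_measurable torus"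
      by (intro measurable_torus borel_measurable_continuous_onI continuous_intros
          continuous_on_compose2[OF cont_\<psi>] continuous_on_compose2[OF cont_F, of _ "\<lambda>x. (t, x)", simplified]; simp)+
    have "(LINT x|meas_of (\<lambda>x. (?r t x)\<^sup>2).
           deriv (\<lambda>s. \<phi> s x) t + grad (\<phi> t) x \<bullet> 0 + root_rate p q t x * \<phi> t x) =
        (LINT x|torus. (\<psi> (t, x) + root_rate p q t x * \<phi> t x) * (?r t x)\<^sup>2)"
      unfolding DERIV_imp_deriv[OF der] inner_zero_right add_0_right
      by (rule integral_meas_of) (auto simp: root_rate_def root_interp_def)
    also have "\<dots> = (LINT x|torus. G t x)"
      unfolding G_def root_rate_mult_square[symmetric] by (simp add: algebra_simps)
    finally show ?thesis .
  qed
  then have "(LBINT t:{0..1}. (LINT x|meas_of (\<lambda>x. (?r t x)\<^sup>2).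
           deriv (\<lambda>s. \<phi> s x) t + grad (\<phi> t) x \<bullet> 0 + root_rate p q t x * \<phi> t x)) =
        (LINT t|lborel. (LINT x|torus. ?I t x))"
    by (simp add: set_lebesgue_integral_def)
  also have "\<dots> = (LINT x|torus. (LINT t|lborel. ?I t x))"
    using P.Fubini_integral[OF int] by simp
  also have "\<dots> = 0"
  proof -
    have "(LINT t|lborel. ?I t x) = 0" for x
    proof -
      have "(LBINT t. indicator {0..1} t *\<^sub>R G t x) = \<phi> 1 x * (?r 1 x)\<^sup>2 - \<phi> 0 x * (?r 0 x)\<^sup>2"
      proof (rule integral_FTC_atLeastAtMost)
        show "((\<lambda>t. \<phi> t x * (?r t x)\<^sup>2) has_vector_derivative G t x) (at t within {0..1})" for t
          unfolding has_real_derivative_iff_has_vector_derivative[symmetric] G_def root_interp_def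
          by (rule DERIV_subset[of _ _ _ UNIV]) (auto intro!: derivative_eq_intros der simp: algebra_simps)
        have "continuous_on {0..1} (\<lambda>t. \<phi> t x)"
          using der by (meson DERIV_isCont continuous_at_imp_continuous_on)
        then show "continuous_on {0..1} (\<lambda>t. G t x)"
          unfolding G_def root_interp_def
          by (intro continuous_intros continuous_on_compose2[OF cont_\<psi>]) auto
      qed simp
      then show ?thesis by (simp add: ends)
    qed
    then show ?thesis by simp
  qed
  finally show "(LBINT t:{0..1}. (LINT x|meas_of (\<lambda>x. (?r t x)\<^sup>2).
           deriv (\<lambda>s. \<phi> s x) t + grad (\<phi> t) x \<bullet> 0 + root_rate p q t x * \<phi> t x)) = 0" .
qed


lemma HK_action_root_interp_le:
  fixes p q :: "real^'n \<Rightarrow> real"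
  assumes [measurable]: "p \<in> borel_measurable torus" "q \<in> borel_measurable torus"
  shows "HK_action (\<lambda>t. meas_of (\<lambda>x. (root_interp p q t x)\<^sup>2)) (root_rate p q) (\<lambda>t x. 0)
    \<le> (\<integral>\<^sup>+x. ennreal (4 * (q x - p x)\<^sup>2) \<partial>torus)" (is "_ \<le> ?J")
proof -
  have [measurable]: "root_interp p q t \<in> borel_measurable torus" "root_rate p q t \<in> borel_measurable torus" for t
    unfolding root_rate_def root_interp_def by measurable
  have inner: "(\<integral>\<^sup>+x. ennreal ((norm (0 :: real^'n))\<^sup>2 + \<bar>root_rate p q t x\<bar>\<^sup>2)
      \<partial>meas_of (\<lambda>x. (root_interp p q t x)\<^sup>2)) \<le> ?J" for t
    unfolding meas_of_def
    by (subst nn_integral_density)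
       (auto intro!: nn_integral_mono ennreal_leI
         simp: ennreal_mult[symmetric] root_rate_square_mult_square[THEN order_trans[OF eq_refl[OF mult.commute]]])
  have "HK_action (\<lambda>t. meas_of (\<lambda>x. (root_interp p q t x)\<^sup>2)) (root_rate p q) (\<lambda>t x. 0)
      \<le> (\<integral>\<^sup>+t. ?J * indicator {0..1::real} t \<partial>lborel)"
    unfolding HK_action_def by (intro nn_integral_mono mult_right_mono inner) auto
  also have "\<dots> = ?J"
    by (subst nn_integral_cmult_indicator) auto
  finally show ?thesis .
qed

lemma HK_dist_sq_le_Hellinger:
  fixes p q :: "real^'n \<Rightarrow> real"
  assumes [measurable]: "p \<in> borel_measurable torus" "q \<in> borel_measurable torus"
    and p: "integrable torus (\<lambda>x. (p x)\<^sup>2)" and q: "integrable torus (\<lambda>x. (q x)\<^sup>2)"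
    and nonneg: "\<And>x. 0 \<le> p x" "\<And>x. 0 \<le> q x"
  shows "HK_dist_sq (meas_of (\<lambda>x. (p x)\<^sup>2)) (meas_of (\<lambda>x. (q x)\<^sup>2))
    \<le> (\<integral>\<^sup>+x. ennreal (4 * (q x - p x)\<^sup>2) \<partial>torus)" (is "_ \<le> ?J")
proof -
  let ?\<rho> = "\<lambda>t. meas_of (\<lambda>x. (root_interp p q t x)\<^sup>2)"
  let ?A = "HK_action ?\<rho> (root_rate p q) (\<lambda>t x. 0)"
  note action = HK_action_root_interp_le[OF assms(1,2)]
  have "integrable torus (\<lambda>x. 4 * (q x - p x)\<^sup>2)"
    unfolding power2_diff mult.assoc
    using p q integrable_root_products[OF assms(2,1) q p] by (intro integrable_mult_right) auto
  then have "?J < \<infinity>"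
    unfolding integrable_iff_bounded by (simp only: real_norm_def abs_mult abs_power2) simp
  then have fin: "?A < \<infinity>"
    using action by (rule order.strict_trans1[rotated])
  have "(\<lambda>(t, x). root_rate p q t x) \<in> borel_measurable (restrict_space lborel {0..1} \<Otimes>\<^sub>M torus)"
  proof -
    have [measurable]: "(\<lambda>x. x) \<in> borel_measurable (restrict_space lborel {0..1::real})"
      by (intro measurable_restrict_space1) simp
    show ?thesis
      unfolding root_rate_def root_interp_def by measurable
  qed
  then have "(?\<rho>, root_rate p q, \<lambda>t x. 0) \<in> HK_admissible (meas_of (\<lambda>x. (p x)\<^sup>2)) (meas_of (\<lambda>x. (q x)\<^sup>2))"
    unfolding HK_admissible_def
    using fin weakly_continuous_root_interp[OF assms(1-4)] weak_continuity_root_interp[OF assms]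
    by (simp add: root_interp_def)
  then have "HK_dist_sq (meas_of (\<lambda>x. (p x)\<^sup>2)) (meas_of (\<lambda>x. (q x)\<^sup>2)) \<le> ?A"
    unfolding HK_dist_sq_def by (rule INF_lower2) simp
  then show ?thesis
    using action by (rule order_trans)
qed

section \<open>The entropy density controls the Hellinger density\<close>

text \<open>
  With \<open>g = f(x, \<sqdot>)\<close> this is the estimate at one point \<open>x\<close>. Below \<open>m\<close> the bound \<open>g(\<xi>) \<ge> c (m - \<xi>) / 2\<close>
  integrates to \<open>c (m - u)\<^sup>2 / 4\<close>, and \<open>(m - u)\<^sup>2 = (\<surd>m - \<surd>u)\<^sup>2 (\<surd>m + \<surd>u)\<^sup>2 \<ge> m (\<surd>m - \<surd>u)\<^sup>2\<close>. Above \<open>m\<close> the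
  comparison function \<open>1 - \<surd>(m/\<xi>)\<close> is the derivative of \<open>(\<surd>\<xi> - \<surd>m)\<^sup>2\<close>; it stays bounded, as
  it must, since \<open>-g\<close> may stop growing beyond \<open>2 m\<close>.
\<close>

lemma integral_ge_Hellinger:
  fixes g g' :: "real \<Rightarrow> real"
  assumes m: "0 < m" and c: "0 < c" and u: "0 \<le> u"
    and int: "\<And>b. set_integrable lborel {0<..<b} g"
    and der: "\<And>\<xi>. 0 < \<xi> \<Longrightarrow> (g has_real_derivative g' \<xi>) (at \<xi>)"
    and neg: "\<And>\<xi>. 0 < \<xi> \<Longrightarrow> g' \<xi> \<le> 0"
    and slope: "\<And>\<xi>. m / 2 \<le> \<xi> \<Longrightarrow> \<xi> \<le> 2 * m \<Longrightarrow> g' \<xi> \<le> - c"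
    and zero: "g m = 0"
  shows "c * m / 4 * (sqrt u - sqrt m)\<^sup>2 \<le> - (LBINT \<xi>=ereal m..ereal u. g \<xi>)"
proof -
  have anti: "g b \<le> g a" if "0 < a" "a \<le> b" for a b
  proof (rule DERIV_nonpos_imp_nonincreasing[OF that(2)])
    fix x assume "a \<le> x"
    then show "\<exists>y. (g has_real_derivative y) (at x) \<and> y \<le> 0"
      using der[of x] neg[of x] that by (intro exI[of _ "g' x"]) auto
  qed
  have steep: "g b + c * b \<le> g a + c * a" if "m / 2 \<le> a" "a \<le> b" "b \<le> 2 * m" for a b
  proof (rule DERIV_nonpos_imp_nonincreasing[OF that(2)])
    fix x assume "a \<le> x" "x \<le> b"
    then have "0 < x" "g' x + c \<le> 0"
      using that m slope[of x] by auto
    then show "\<exists>y. ((\<lambda>b. g b + c * b) has_real_derivative y) (at x) \<and> y \<le> 0"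
      by (intro exI[of _ "g' x + c"]) (auto intro!: derivative_eq_intros der)
  qed
  \<comment> \<open>For \<open>\<xi> \<le> m/2\<close> one has \<open>g(\<xi>) \<ge> g(m/2) \<ge> c m / 2\<close>, whence the factor \<open>1/2\<close>.\<close>
  have below: "c / 2 * (m - \<xi>) \<le> g \<xi>" if "0 < \<xi>" "\<xi> \<le> m" for \<xi>
  proof (cases "m / 2 \<le> \<xi>")
    case True
    have "0 \<le> c * (m - \<xi>)" using that c by simp
    then show ?thesis
      using steep[of \<xi> m] True that m zero by (simp add: algebra_simps)
  next
    case False
    have "0 \<le> c * \<xi>" using that c by simp
    then show ?thesis
      using steep[of "m / 2" m] anti[of \<xi> "m / 2"] False that m zero by (simp add: algebra_simps)
  qed
  have above: "c * m * (1 - sqrt m / sqrt \<xi>) \<le> - g \<xi>" if "m \<le> \<xi>" for \<xi>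
  proof -
    have pos: "0 < \<xi>" using that m by simp
    have "m / \<xi> = (sqrt m / sqrt \<xi>)\<^sup>2"
      using m pos by (simp add: power_divide)
    also have "\<dots> \<le> sqrt m / sqrt \<xi>"
      unfolding power2_eq_square using that m pos by (intro mult_left_le) auto
    \<comment> \<open>The rational function lies above the irrational one and below both \<open>(\<xi> - m)/m\<close> and \<open>1\<close>,
      which are the available bounds on either side of \<open>2 m\<close>.\<close>
    finally have "c * m * (1 - sqrt m / sqrt \<xi>) \<le> c * m * (1 - m / \<xi>)"
      using m c by (intro mult_left_mono) auto
    also have "\<dots> \<le> - g \<xi>"
    proof (cases "\<xi> \<le> 2 * m")
      case True
      have "c * m * (1 - m / \<xi>) = c * (\<xi> - m) * (m / \<xi>)"
        using pos by (simp add: field_simps)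
      also have "\<dots> \<le> c * (\<xi> - m) * 1"
        using that c m pos by (intro mult_left_mono) auto
      also have "\<dots> \<le> - g \<xi>"
        using steep[of m \<xi>] that True m zero by (simp add: algebra_simps)
      finally show ?thesis .
    next
      case False
      have "c * m * (1 - m / \<xi>) \<le> c * m * 1"
        using c m pos by (intro mult_left_mono) auto
      also have "\<dots> \<le> - g \<xi>"
        using steep[of m "2 * m"] anti[of "2 * m" \<xi>] False m zero by (simp add: algebra_simps)
      finally show ?thesis .
    qed
    finally show ?thesis .
  qed
  have int': "set_integrable lborel {a<..<b} g" if "0 \<le> a" for a b
    by (rule set_integrable_subset[OF int[of b]]) (use that in auto)
  show ?thesis
  proof (cases "u \<le> m")
    case True
    have "(sqrt m - sqrt u)\<^sup>2 * m \<le> (sqrt m - sqrt u)\<^sup>2 * (sqrt m + sqrt u)\<^sup>2"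
    proof (rule mult_left_mono)
      have "(sqrt m)\<^sup>2 \<le> (sqrt m + sqrt u)\<^sup>2"
        using u m by (intro power_mono) auto
      then show "m \<le> (sqrt m + sqrt u)\<^sup>2" using m by simp
    qed simp
    also have "\<dots> = ((sqrt m - sqrt u) * (sqrt m + sqrt u))\<^sup>2"
      by (simp only: power_mult_distrib)
    also have "(sqrt m - sqrt u) * (sqrt m + sqrt u) = m - u"
      using m u by (simp add: algebra_simps)
    finally have "c * m / 4 * (sqrt u - sqrt m)\<^sup>2 \<le> c / 4 * (m - u)\<^sup>2"
      using c by (simp add: power2_commute mult.commute mult.left_commute)
    also have "\<dots> = (LBINT \<xi>=ereal u..ereal m. c / 2 * (m - \<xi>))"
      using True by (subst interval_integral_FTC_finite[where F="\<lambda>\<xi>. - (c / 4 * (m - \<xi>)\<^sup>2)"])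
         (auto intro!: continuous_intros derivative_eq_intros
           simp: has_real_derivative_iff_has_vector_derivative[symmetric] field_simps)
    also have "\<dots> \<le> (LBINT \<xi>=ereal u..ereal m. g \<xi>)"
    proof -
      have "set_integrable lborel {u<..<m} (\<lambda>\<xi>. c / 2 * (m - \<xi>))"
        by (rule set_integrable_subset[OF borel_integrable_atLeastAtMost'[of u m]])
           (auto intro!: continuous_intros)
      then show ?thesis
        unfolding interval_lebesgue_integral_le_eq[OF ereal_less_eq(3)[THEN iffD2, OF True]] einterval_eq
        using int'[OF u] below u by (intro set_integral_mono) auto
    qed
    also have "\<dots> = - (LBINT \<xi>=ereal m..ereal u. g \<xi>)"
      by (subst interval_integral_endpoints_reverse) simp
    finally show ?thesis .
  next
    case False
    then have mu: "m \<le> u" by simp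
    have cont: "continuous_on {m..u} (\<lambda>\<xi>. c * m * (1 - sqrt m / sqrt \<xi>))"
      using m by (intro continuous_intros) auto
    have "c * m / 4 * (sqrt u - sqrt m)\<^sup>2 \<le> c * m * (sqrt u - sqrt m)\<^sup>2"
      using c m by (intro mult_right_mono) auto
    also have "\<dots> = (LBINT \<xi>=ereal m..ereal u. c * m * (1 - sqrt m / sqrt \<xi>))"
    proof (subst interval_integral_FTC_finite[where F="\<lambda>\<xi>. c * m * (sqrt \<xi> - sqrt m)\<^sup>2"])
      fix x assume "min m u \<le> x" "x \<le> max m u"
      then have "0 < x" using m mu by simp
      then have "((\<lambda>\<xi>. c * m * (sqrt \<xi> - sqrt m)\<^sup>2) has_real_derivative c * m * (1 - sqrt m / sqrt x)) (at x)"
        by (auto intro!: derivative_eq_intros simp: field_simps)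
      then show "((\<lambda>\<xi>. c * m * (sqrt \<xi> - sqrt m)\<^sup>2) has_vector_derivative c * m * (1 - sqrt m / sqrt x))
          (at x within {min m u..max m u})"
        unfolding has_real_derivative_iff_has_vector_derivative[symmetric]
        by (rule DERIV_subset) simp
    qed (use cont mu in auto)
    also have "\<dots> \<le> (LBINT \<xi>=ereal m..ereal u. - g \<xi>)"
    proof -
      have "set_integrable lborel {m<..<u} (\<lambda>\<xi>. c * m * (1 - sqrt m / sqrt \<xi>))"
        by (rule set_integrable_subset[OF borel_integrable_atLeastAtMost'[OF cont]]) auto
      moreover have "set_integrable lborel {m<..<u} (\<lambda>\<xi>. - g \<xi>)"
        using int'[of m u] m by (simp add: set_integrable_def)
      ultimately show ?thesis
        unfolding interval_lebesgue_integral_le_eq[OF ereal_less_eq(3)[THEN iffD2, OF mu]] einterval_eq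
        using above by (intro set_integral_mono) auto
    qed
    also have "\<dots> = - (LBINT \<xi>=ereal m..ereal u. g \<xi>)"
      by (rule interval_lebesgue_integral_uminus)
    finally show ?thesis .
  qed
qed

text \<open>
  Near \<open>0\<close> the function \<open>f(x, \<sqdot>)\<close> may be unbounded, and an entropy integral that diverged would
  be assigned the value \<open>0\<close>; the majorant excludes this.
\<close>

lemma set_integrable_dominated_by_L1_loc:
  fixes h g1 :: "real \<Rightarrow> real"
  assumes g1: "L1_loc g1 {0..}" and h: "continuous_on {0<..} h"
    and bound: "AE u in lborel. u > 0 \<longrightarrow> \<bar>h u\<bar> \<le> g1 u"
  shows "set_integrable lborel {0<..<b} h"
proof -
  have "set_integrable lebesgue {0..b} g1"
    using g1 unfolding L1_loc_def by auto
  then have g1': "set_integrable lebesgue {0<..<b} g1"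
    by (rule set_integrable_subset) auto
  have "continuous_on {0<..<b} h"
    using h by (rule continuous_on_subset) auto
  then have m: "set_borel_measurable lborel {0<..<b} h"
    unfolding set_borel_measurable_def using borel_measurable_continuous_on_indicator[of "{0<..<b}" h] by simp
  have "set_integrable lebesgue {0<..<b} h"
  proof (rule set_integrable_bound[OF g1'])
    show "set_borel_measurable lebesgue {0<..<b} h"
      using m unfolding set_borel_measurable_def by (rule measurable_completion)
    show "AE x in lebesgue. x \<in> {0<..<b} \<longrightarrow> norm (h x) \<le> norm (g1 x)"
      using AE_completion[OF bound] by eventually_elim auto
  qed
  then show ?thesis
    using m unfolding set_integrable_def set_borel_measurable_def by (simp add: integrable_completion)
qed

text \<open>
  For a level \<open>a\<close> below the zero \<open>m(x)\<close> one has \<open>f(x, a) > 0\<close>. This sign persists for nearby \<open>y\<close>, and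
  by monotonicity it says that \<open>m(y) > a\<close>; likewise from above.
\<close>

lemma continuous_on_decreasing_root:
  fixes f :: "'a::topological_space \<Rightarrow> real \<Rightarrow> real"
  assumes cont: "\<And>u. u > 0 \<Longrightarrow> continuous_on UNIV (\<lambda>x. f x u)"
    and decr: "\<And>x a b. 0 < a \<Longrightarrow> a < b \<Longrightarrow> f x b < f x a"
    and m_pos: "\<And>x. m x > 0" and m_zero: "\<And>x. f x (m x) = 0"
  shows "continuous_on UNIV m"
proof -
  have tends: "((\<lambda>y. f y u) \<longlongrightarrow> f x u) (at x)" if "u > 0" for u x
    using cont[OF that] by (simp add: continuous_on_def)
  have "(m \<longlongrightarrow> m x) (at x)" for x
  proof (rule order_tendstoI)
    fix a assume a: "a < m x"
    show "\<forall>\<^sub>F y in at x. a < m y"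
    proof (cases "a > 0")
      case True
      have "\<forall>\<^sub>F y in at x. 0 < f y a"
        using tends[OF True, of x] decr[OF True a, of x] m_zero[of x] by (intro order_tendstoD(1)) auto
      then show ?thesis
      proof eventually_elim
        case (elim y)
        show ?case
        proof (rule ccontr)
          assume "\<not> a < m y"
          then show False
            using elim decr[OF m_pos[of y], of a y] m_zero[of y] by (cases "m y = a") auto
        qed
      qed
    next
      case False
      then show ?thesis
        by (intro always_eventually allI le_less_trans[of a 0]) (auto simp: m_pos)
    qed
  next
    fix a assume a: "m x < a"
    then have pos: "a > 0" using m_pos less_trans by blast
    have "\<forall>\<^sub>F y in at x. f y a < 0"
      using tends[OF pos, of x] decr[OF m_pos a, of x] m_zero[of x] by (intro order_tendstoD(2)) auto
    then show "\<forall>\<^sub>F y in at x. m y < a"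
    proof eventually_elim
      case (elim y)
      show ?case
      proof (rule ccontr)
        assume "\<not> m y < a"
        then show False
          using elim decr[OF pos, of "m y" y] m_zero[of y] by (cases "m y = a") auto
      qed
    qed
  qed
  then show ?thesis
    by (simp add: continuous_on_def)
qed


text \<open>
  Compactness of the cube times the range \<open>[min m / 2, 2 max m]\<close>, which contains all intervals
  \<open>[m(x)/2, 2 m(x)]\<close>, makes the constant of the pointwise estimate uniform.
\<close>

lemma entropy_density_ge_Hellinger:
  fixes f :: "real^'n \<Rightarrow> real \<Rightarrow> real" and m :: "real^'n \<Rightarrow> real"
  assumes C1: "Ck_on 1 (\<lambda>(x, u). f x u) (UNIV \<times> {0<..})"
    and fu_neg: "\<And>x u. u > 0 \<Longrightarrow> deriv (f x) u < 0"
    and g1: "L1_loc g1 {0..}" "\<And>x. AE u in lborel. u > 0 \<longrightarrow> \<bar>f x u\<bar> \<le> g1 u"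
    and m_pos: "\<And>x. m x > 0" and m_zero: "\<And>x. f x (m x) = 0"
  obtains D where "continuous_on UNIV m" "0 < D"
    "\<And>x u. x \<in> cube \<Longrightarrow> 0 \<le> u \<Longrightarrow> D * (sqrt u - sqrt (m x))\<^sup>2 \<le> entropy_density f m x u"
proof -
  let ?F = "\<lambda>(x, u). f x u"
  define fu where "fu = (\<lambda>z. frechet_derivative ?F (at z) (0, 1))"
  have diff: "?F differentiable (at (x, u))" if "u > 0" for x u
    using C1 that by simp
  have cont_fu: "continuous_on (UNIV \<times> {0<..}) fu"
    using C1 unfolding fu_def by (simp add: Basis_prod_def)
  have der: "(f x has_real_derivative fu (x, u)) (at u)" if "u > 0" for x u
    using has_real_derivative_snd[OF diff[OF that, of x]] by (simp add: fu_def)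
  have neg: "fu (x, u) < 0" if "u > 0" for x u
    using fu_neg[OF that, of x] DERIV_imp_deriv[OF der[OF that, of x]] by simp
  have cont_F: "continuous_on (UNIV \<times> {0<..}) ?F"
    using diff by (auto intro!: continuous_at_imp_continuous_on differentiable_imp_continuous_within)
  have decr: "f x b < f x a" if "0 < a" "a < b" for x a b
  proof (rule DERIV_neg_imp_decreasing[OF that(2)])
    fix y assume "a \<le> y"
    then show "\<exists>d. (f x has_real_derivative d) (at y) \<and> d < 0"
      using der[of y x] neg[of y x] that by (intro exI[of _ "fu (x, y)"]) auto
  qed
  have cont_m: "continuous_on UNIV m"
  proof (rule continuous_on_decreasing_root[where f=f])
    show "continuous_on UNIV (\<lambda>x. f x u)" if "u > 0" for u
      using that by (intro continuous_on_compose2[OF cont_F, of _ "\<lambda>x. (x, u)", simplified] continuous_intros) auto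
  qed (use decr m_pos m_zero in auto)
  have cube: "compact (cube :: (real^'n) set)" "(cube :: (real^'n) set) \<noteq> {}"
    by (auto simp: mem_box_cart intro!: ex_in_conv[THEN iffD1] exI[of _ 0])
  have cont_m_cube: "continuous_on cube m"
    by (rule continuous_on_subset[OF cont_m]) simp
  obtain x0 where x0: "x0 \<in> cube" "\<And>x. x \<in> cube \<Longrightarrow> m x0 \<le> m x"
    using continuous_attains_inf[OF cube cont_m_cube] by auto
  obtain x1 where x1: "x1 \<in> cube" "\<And>x. x \<in> cube \<Longrightarrow> m x \<le> m x1"
    using continuous_attains_sup[OF cube cont_m_cube] by auto
  let ?K = "(cube :: (real^'n) set) \<times> {m x0 / 2..2 * m x1}"
  have "compact ?K" "(x0, m x0) \<in> ?K" "?K \<subseteq> UNIV \<times> {0<..}"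
    using cube x0 x1(2)[OF x0(1)] m_pos[of x0] by (auto intro: compact_Times)
  then obtain z where z: "z \<in> ?K" "\<And>y. y \<in> ?K \<Longrightarrow> fu y \<le> fu z"
    using continuous_attains_sup[of ?K fu] continuous_on_subset[OF cont_fu, of ?K] by blast
  define c where "c = - fu z"
  have c: "0 < c"
    using z(1) neg[of "snd z" "fst z"] m_pos[of x0] unfolding c_def by auto
  have slope: "fu (x, \<xi>) \<le> - c" if "x \<in> cube" "m x / 2 \<le> \<xi>" "\<xi> \<le> 2 * m x" for x \<xi>
    using z(2)[of "(x, \<xi>)"] that x0(2)[of x] x1(2)[of x] unfolding c_def by auto
  show ?thesis
  proof (rule that[of "c * m x0 / 4"])
    fix x :: "real^'n" and u :: real
    assume x: "x \<in> cube" and u: "0 \<le> u"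
    have "continuous_on {0<..} (f x)"
      using der by (intro continuous_at_imp_continuous_on) (auto intro: DERIV_isCont)
    then have int: "set_integrable lborel {0<..<b} (f x)" for b
      using g1 by (intro set_integrable_dominated_by_L1_loc) auto
    have "c * m x0 / 4 * (sqrt u - sqrt (m x))\<^sup>2 \<le> c * m x / 4 * (sqrt u - sqrt (m x))\<^sup>2"
      using c x0(2)[OF x] by (intro mult_right_mono) auto
    also have "\<dots> \<le> entropy_density f m x u"
      unfolding entropy_density_def
      using der neg slope[OF x]
      by (intro integral_ge_Hellinger[OF m_pos c u int, where g'="\<lambda>\<xi>. fu (x, \<xi>)"])
         (auto simp: m_zero less_imp_le)
    finally show "c * m x0 / 4 * (sqrt u - sqrt (m x))\<^sup>2 \<le> entropy_density f m x u" .
  qed (use cont_m c m_pos in auto)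
qed

section \<open>The entropy controls the Hellinger--Kantorovich distance\<close>

theorem theorem3p19:
  fixes f :: "real^'n \<Rightarrow> real \<Rightarrow> real"
    and m :: "real^'n \<Rightarrow> real"
  assumes f_periodic: "\<And>u. u > 0 \<Longrightarrow> periodic (\<lambda>x. f x u)"
    and f_C2: "Ck_on 2 (\<lambda>(x, u). f x u) (UNIV \<times> {0<..})"
    and f_L1loc: "L1_loc (\<lambda>(x, u). f x u) (UNIV \<times> {0..})"
    and uf_cont: "continuous_up_to_0 (\<lambda>x u. u * f x u)"
    and ufx_cont: "continuous_up_to_0 (\<lambda>x u. u *\<^sub>R grad (\<lambda>y. f y u) x)"
    and fu_neg: "\<And>x u. u > 0 \<Longrightarrow> deriv (f x) u < 0"
    and f_bound: "\<exists>g1. L1_loc g1 {0..} \<and> (\<forall>x. AE u in lborel. u > 0 \<longrightarrow> \<bar>f x u\<bar> \<le> g1 u)"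
    and m_periodic: "periodic m"
    and m_pos: "\<And>x. m x > 0"
    and m_zero: "\<And>x. f x (m x) = 0"
  shows "\<exists>C\<ge>0. \<forall>u0 :: real^'n \<Rightarrow> real.
           integrable torus u0 \<and> (AE x in torus. u0 x \<ge> 0) \<and> entropy f m u0 < \<infinity> \<longrightarrow>
           HK_dist_sq (meas_of u0) (meas_of m) \<le> ennreal C * entropy f m u0"
proof -
  have C1: "Ck_on 1 (\<lambda>(x, u). f x u) (UNIV \<times> {0<..})"
    using Ck_on_Suc_imp[OF f_C2[unfolded numeral_2_eq_2]] by simp
  obtain g1 where g1: "L1_loc g1 {0..}" "\<And>x. AE u in lborel. u > 0 \<longrightarrow> \<bar>f x u\<bar> \<le> g1 u"
    using f_bound by blast
  obtain D where cont_m: "continuous_on UNIV m" and D: "0 < D"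
    and density: "\<And>x u. x \<in> cube \<Longrightarrow> 0 \<le> u \<Longrightarrow> D * (sqrt u - sqrt (m x))\<^sup>2 \<le> entropy_density f m x u"
    by (rule entropy_density_ge_Hellinger[OF C1 _ g1, where m=m])
      (erule fu_neg, rule m_pos, rule m_zero, blast)
  interpret T: finite_measure "torus :: (real^'n) measure" by (rule finite_measure_torus)
  have int_m: "integrable torus m"
    using integrable_torus_continuous_mult[OF cont_m, of "\<lambda>_. 1"] by simp
  have "HK_dist_sq (meas_of u0) (meas_of m) \<le> ennreal (4 / D) * entropy f m u0"
    if int_u: "integrable torus u0" and nonneg: "AE x in torus. u0 x \<ge> 0" for u0 :: "real^'n \<Rightarrow> real"
  proof -
    define p where "p x = sqrt (max 0 (u0 x))" for x
    define q where "q x = sqrt (m x)" for x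
    have [measurable]: "p \<in> borel_measurable torus" "q \<in> borel_measurable torus"
      using int_u int_m unfolding p_def q_def by auto
    have p2: "(p x)\<^sup>2 = max 0 (u0 x)" and q2: "(q x)\<^sup>2 = m x" for x
      using m_pos[of x] by (auto simp: p_def q_def)
    \<comment> \<open>Negative values of \<open>u\<^sup>0\<close> are cut off by \<open>ennreal\<close> in the density of the measure as well.\<close>
    have "meas_of u0 = meas_of (\<lambda>x. (p x)\<^sup>2)"
    proof -
      have "ennreal ((p x)\<^sup>2) = ennreal (u0 x)" for x
        unfolding p2 by (cases "0 \<le> u0 x") (simp_all add: ennreal_neg)
      then show ?thesis
        by (simp add: meas_of_def)
    qed
    then have "HK_dist_sq (meas_of u0) (meas_of m) = HK_dist_sq (meas_of (\<lambda>x. (p x)\<^sup>2)) (meas_of (\<lambda>x. (q x)\<^sup>2))"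
      by (simp add: q2)
    also have "\<dots> \<le> (\<integral>\<^sup>+x. ennreal (4 * (q x - p x)\<^sup>2) \<partial>torus)"
    proof (rule HK_dist_sq_le_Hellinger)
      show "integrable torus (\<lambda>x. (p x)\<^sup>2)" "integrable torus (\<lambda>x. (q x)\<^sup>2)"
        using int_u int_m by (simp_all add: p2 q2)
      show "0 \<le> p x" "0 \<le> q x" for x
        using m_pos[of x] by (simp_all add: p_def q_def)
    qed measurable
    also have "\<dots> = (\<integral>\<^sup>+x. ennreal (4 / D) * ennreal (D * (p x - q x)\<^sup>2) \<partial>torus)"
      using D by (simp add: ennreal_mult[symmetric] power2_commute[of "p _"])
    also have "\<dots> = ennreal (4 / D) * (\<integral>\<^sup>+x. ennreal (D * (p x - q x)\<^sup>2) \<partial>torus)"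
      by (rule nn_integral_cmult) measurable
    also have "\<dots> \<le> ennreal (4 / D) * entropy f m u0"
    proof (rule mult_left_mono)
      have "AE x in torus. ennreal (D * (p x - q x)\<^sup>2) \<le> ennreal (entropy_density f m x (u0 x))"
        using nonneg AE_space
      proof eventually_elim
        case (elim x)
        then show ?case
          using density[of x "u0 x"] space_torus_subset by (auto simp: p_def q_def max_def intro!: ennreal_leI)
      qed
      then show "(\<integral>\<^sup>+x. ennreal (D * (p x - q x)\<^sup>2) \<partial>torus) \<le> entropy f m u0"
        unfolding entropy_def by (rule nn_integral_mono_AE)
    qed simp
    finally show ?thesis .
  qed
  then show ?thesis
    using D by (intro exI[of _ "4 / D"]) auto
qed

end
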